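(* Let $0<\alpha<1$ and $0\le\rho<1-(1+\alpha)^{-1/2}$ be real numbers. Let $q,n,d,\ell,m$ be positive integers and let $\mathcal{C}\subseteq[q]^n$ be a code of minimum distance at least $n-nq^{-1}-d$. Put $\gamma=(1+\alpha)(1-\rho)^2-1$ and $\sigma=(1-\rho)(2-\rho)^{-1}$. Suppose \[ d\ge nq^{-1},\qquad 4\gamma^{-1}\le\ell\le \tfrac{1}{800}\,\sigma\gamma\, n d^{-1},\qquad \sigma m\ge 1280\sqrt{\ell\gamma^{-1}}\,\log|\mathcal{C}|,\qquad m<n. \] Then for $S$ chosen uniformly at random among the $m$-element subsets of $[n]$, the probability that $\mathcal{C}_S$ is $(\rho,\ell,\ell(1+\alpha))$-list recoverable is at least $1-e^{-\sigma m/64}$.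
   Context: For $c\in[q]^N$ and $\mathcal{L}\subseteq[q]^N$, $\Delta(c,\mathcal{L})$ is the minimum Hamming distance from $c$ to an element of $\mathcal{L}$. A code $\mathcal{C}\subseteq[q]^N$ is $(\rho,\ell,L)$-list recoverable if for all $A_1,\dots,A_N\subseteq[q]$ with each $|A_i|\le\ell$, at most $L$ codewords $c\in\mathcal{C}$ satisfy $\Delta(c,A_1\times\cdots\times A_N)\le\rho N$. For $S\subseteq[n]$, $\mathcal{C}_S\subseteq[q]^S$ is the puncturing of $\mathcal{C}$ to $S$, i.e. the set of restrictions of codewords of $\mathcal{C}$ to the coordinates in $S$ (block length $|S|$). $\log$ denotes the natural logarithm. *)

theory Defs
  imports "HOL-Probability.Probability"
begin

text \<open>Words over the alphabet [q] = {0..<q} indexed by a finite coordinate set I are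
  extensional functions in PiE I (\<lambda>_. {..<q}).  A code is a set of such words.\<close>

definition hamming :: "nat set \<Rightarrow> (nat \<Rightarrow> nat) \<Rightarrow> (nat \<Rightarrow> nat) \<Rightarrow> nat" where
  "hamming I c c' = card {i \<in> I. c i \<noteq> c' i}"

definition dist_to_le :: "nat set \<Rightarrow> (nat \<Rightarrow> nat) \<Rightarrow> (nat \<Rightarrow> nat) set \<Rightarrow> real \<Rightarrow> bool" where
  "dist_to_le I c L r \<longleftrightarrow> L \<noteq> {} \<and> real (Min ((\<lambda>y. hamming I c y) ` L)) \<le> r"

definition list_recoverable ::
  "nat set \<Rightarrow> nat \<Rightarrow> real \<Rightarrow> nat \<Rightarrow> real \<Rightarrow> (nat \<Rightarrow> nat) set \<Rightarrow> bool" where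
  "list_recoverable I q \<rho> l L C \<longleftrightarrow>
     (\<forall>A :: nat \<Rightarrow> nat set. (\<forall>i\<in>I. A i \<subseteq> {..<q} \<and> card (A i) \<le> l) \<longrightarrow>
        real (card {c \<in> C. dist_to_le I c (PiE I A) (\<rho> * real (card I))}) \<le> L)"

definition min_dist_ge :: "nat set \<Rightarrow> (nat \<Rightarrow> nat) set \<Rightarrow> real \<Rightarrow> bool" where
  "min_dist_ge I C D \<longleftrightarrow> (\<forall>c\<in>C. \<forall>c'\<in>C. c \<noteq> c' \<longrightarrow> real (hamming I c c') \<ge> D)"

definition puncture :: "(nat \<Rightarrow> nat) set \<Rightarrow> nat set \<Rightarrow> (nat \<Rightarrow> nat) set" where
  "puncture C S = (\<lambda>c. restrict c S) ` C"

end

theory Submission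
  imports Defs
begin

text \<open>Write \<open>\<gamma>\<close> and \<open>\<sigma>\<close> as in the theorem and \<open>R = sqrt (l / \<gamma>)\<close>. If the puncturing to \<open>S\<close> is not
  list recoverable, there are about \<open>(1 + \<alpha>) l\<close> codewords which mostly agree with sets \<open>A i\<close>
  of size at most \<open>l\<close>; by Markov's inequality, on at least \<open>\<sigma> m\<close> of the coordinates \<open>i\<close> in \<open>S\<close> at
  least \<open>(1 + \<gamma>) l\<close> of them take values in \<open>A i\<close>, which leaves at least \<open>\<gamma> l / 2\<close> disjoint pairs of
  codewords that agree at \<open>i\<close>. Keeping every codeword independently with probability
  \<open>2 / sqrt (\<gamma> l)\<close> retains such a pair with constant probability, so some set \<open>T\<close> of at most
  \<open>9 R\<close> codewords already has a collision on \<open>\<sigma> m / 2\<close> coordinates of \<open>S\<close>. By the minimum distance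
  a given \<open>T\<close> has collisions on at most \<open>2 d (9 R)\<^sup>2 \<le> 0.2025 \<sigma> n\<close> coordinates in total, so a random
  \<open>S\<close> meets \<open>\<sigma> m / 2\<close> of them with exponentially small probability. The union bound runs over small sets
  \<open>T\<close> rather than over whole lists.\<close>

section \<open>Averages over independent random subsets\<close>

text \<open>The expectation of \<open>f T\<close> when \<open>T\<close> keeps each element of
  \<open>A\<close> independently with probability \<open>p\<close>, written as a finite sum so that
  induction on \<open>A\<close> applies directly.\<close>

definition subset_mean :: "real \<Rightarrow> 'a set \<Rightarrow> ('a set \<Rightarrow> real) \<Rightarrow> real" where
  "subset_mean p A f = (\<Sum>T\<in>Pow A. p ^ card T * (1 - p) ^ card (A - T) * f T)"

text \<open>Condition on whether \<open>a\<close> is kept.\<close>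

lemma subset_mean_insert:
  assumes "finite A" "a \<notin> A"
  shows "subset_mean p (insert a A) f =
    (1 - p) * subset_mean p A f + p * subset_mean p A (\<lambda>T. f (insert a T))"
proof -
  let ?w = "\<lambda>A T. p ^ card T * (1 - p) ^ card (A - T)"
  have inj: "inj_on (insert a) (Pow A)"
    using assms(2) by (auto simp: inj_on_def)
  have "subset_mean p (insert a A) f =
      (\<Sum>T\<in>Pow A. ?w (insert a A) T * f T)
      + (\<Sum>T\<in>insert a ` Pow A. ?w (insert a A) T * f T)"
    unfolding subset_mean_def Pow_insert
    by (rule sum.union_disjoint) (use assms in auto)
  also have "(\<Sum>T\<in>Pow A. ?w (insert a A) T * f T) = (1 - p) * subset_mean p A f"
    unfolding subset_mean_def sum_distrib_left
  proof (rule sum.cong[OF refl])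
    fix T assume "T \<in> Pow A"
    then have "insert a A - T = insert a (A - T)" using assms(2) by auto
    then show "?w (insert a A) T * f T = (1 - p) * (?w A T * f T)"
      using assms by simp
  qed
  also have "(\<Sum>T\<in>insert a ` Pow A. ?w (insert a A) T * f T) =
      p * subset_mean p A (\<lambda>T. f (insert a T))"
    unfolding subset_mean_def sum_distrib_left sum.reindex[OF inj] comp_def
  proof (rule sum.cong[OF refl])
    fix T assume T: "T \<in> Pow A"
    then have "insert a A - insert a T = A - T" "finite T" "a \<notin> T"
      using assms finite_subset by auto
    then show "?w (insert a A) (insert a T) * f (insert a T) = p * (?w A T * f (insert a T))"
      by simp
  qed
  finally show ?thesis .
qed

lemma subset_mean_empty [simp]: "subset_mean p {} f = f {}"
  by (simp add: subset_mean_def)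

lemma subset_mean_mono:
  assumes "0 \<le> p" "p \<le> 1" "\<And>T. T \<subseteq> A \<Longrightarrow> f T \<le> g T"
  shows "subset_mean p A f \<le> subset_mean p A g"
  unfolding subset_mean_def by (intro sum_mono mult_left_mono) (use assms in auto)

lemma subset_mean_add: "subset_mean p A (\<lambda>T. f T + g T) = subset_mean p A f + subset_mean p A g"
  by (simp add: subset_mean_def algebra_simps sum.distrib)

lemma subset_mean_cmult: "subset_mean p A (\<lambda>T. c * f T) = c * subset_mean p A f"
  by (simp add: subset_mean_def sum_distrib_left mult_ac)

lemma subset_mean_sum:
  "subset_mean p A (\<lambda>T. \<Sum>i\<in>G. f i T) = (\<Sum>i\<in>G. subset_mean p A (f i))"
  unfolding subset_mean_def sum_distrib_left by (rule sum.swap)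

lemma subset_mean_const: "finite A \<Longrightarrow> subset_mean p A (\<lambda>_. c) = c"
  by (induction A rule: finite_induct) (simp_all add: subset_mean_insert algebra_simps)

lemma subset_mean_card: "finite A \<Longrightarrow> subset_mean p A (\<lambda>T. real (card T)) = p * real (card A)"
proof (induction A rule: finite_induct)
  case (insert a A)
  have "subset_mean p A (\<lambda>T. real (card (insert a T))) = subset_mean p A (\<lambda>T. real (card T) + 1)"
    unfolding subset_mean_def
  proof (rule sum.cong[OF refl])
    fix T assume "T \<in> Pow A"
    then have "finite T" "a \<notin> T" using insert finite_subset by auto
    then show "p ^ card T * (1 - p) ^ card (A - T) * real (card (insert a T)) =
        p ^ card T * (1 - p) ^ card (A - T) * (real (card T) + 1)" by simp
  qed
  then show ?case
    using insert by (simp add: subset_mean_insert subset_mean_add subset_mean_const algebra_simps)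
qed simp

lemma exists_ge_subset_mean:
  assumes "finite A" "0 \<le> p" "p \<le> 1"
  obtains T where "T \<subseteq> A" "subset_mean p A f \<le> f T"
proof -
  let ?M = "Max (f ` Pow A)"
  have fin: "finite (f ` Pow A)" "f ` Pow A \<noteq> {}" using assms(1) by auto
  have "subset_mean p A f \<le> subset_mean p A (\<lambda>_. ?M)"
    by (rule subset_mean_mono) (use assms fin in auto)
  also have "\<dots> = ?M" using assms(1) by (rule subset_mean_const)
  finally show ?thesis using Max_in[OF fin] that by auto
qed

text \<open>Two elements with equal value lie in \<open>T\<close> together with probability \<open>p\<^sup>2\<close>; removing
  such a pair lowers the excess \<open>card A - card (v ` A)\<close> by at most two, so \<open>K\<close> disjoint pairs
  can be removed one after the other.\<close>
lemma subset_mean_inj_on_le: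
  assumes "finite A" "0 \<le> p" "p \<le> 1" "card (v ` A) + 2 * K \<le> card A + 1"
  shows "subset_mean p A (\<lambda>T. of_bool (inj_on v T)) \<le> (1 - p\<^sup>2) ^ K"
  using assms(1,4)
proof (induction K arbitrary: A)
  case 0
  have "subset_mean p A (\<lambda>T. of_bool (inj_on v T)) \<le> subset_mean p A (\<lambda>_. 1)"
    by (rule subset_mean_mono) (use assms in auto)
  then show ?case using 0 by (simp add: subset_mean_const)
next
  case (Suc K)
  let ?f = "\<lambda>T. of_bool (inj_on v T) :: real"
  \<comment> \<open>The hypothesis leaves an excess of at least \<open>2 * K + 1\<close>. The
    \<open>+ 1\<close> is affordable because the last pair removed needs an excess of only
    one.\<close>
  have "card (v ` A) \<noteq> card A" using Suc.prems by simp
  then have "\<not> inj_on v A" using card_image by blast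
  then obtain a b where ab: "a \<in> A" "b \<in> A" "a \<noteq> b" "v a = v b" by (auto simp: inj_on_def)
  define A' where "A' = A - {a, b}"
  have A: "A = insert a (insert b A')" "b \<notin> A'" "a \<notin> insert b A'" "finite A'"
    using ab Suc.prems(1) by (auto simp: A'_def)
  have "card A = card A' + 2" using A by simp
  moreover have "card (v ` A') \<le> card (v ` A)"
    by (rule card_mono) (use Suc.prems A in auto)
  ultimately have IH: "subset_mean p A' ?f \<le> (1 - p\<^sup>2) ^ K"
    using Suc.IH[of A'] Suc.prems A(4) by simp
  have le: "subset_mean p A' (\<lambda>T. ?f (insert x T)) \<le> subset_mean p A' ?f" for x
    by (rule subset_mean_mono) (use assms in \<open>auto simp: inj_on_def\<close>)
  have both: "subset_mean p A' (\<lambda>T. ?f (insert a (insert b T))) = 0"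
    using ab(3,4) by (simp add: subset_mean_def inj_on_def)
  \<comment> \<open>Condition on which of \<open>a\<close> and \<open>b\<close> are kept. Keeping
    both destroys injectivity; in the other three cases adding elements can only hurt, so the total
    weight left is \<open>1 - p\<^sup>2\<close>.\<close>
  have "subset_mean p A ?f = (1 - p) * ((1 - p) * subset_mean p A' ?f +
      p * subset_mean p A' (\<lambda>T. ?f (insert b T))) +
      p * ((1 - p) * subset_mean p A' (\<lambda>T. ?f (insert a T)))"
    using A both by (simp add: subset_mean_insert)
  also have "\<dots> \<le> (1 - p) * ((1 - p) * subset_mean p A' ?f + p * subset_mean p A' ?f) +
      p * ((1 - p) * subset_mean p A' ?f)"
    using le assms by (intro add_mono mult_left_mono order_refl) auto
  also have "\<dots> = (1 - p\<^sup>2) * subset_mean p A' ?f"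
    by (simp add: algebra_simps power2_eq_square)
  also have "\<dots> \<le> (1 - p\<^sup>2) * (1 - p\<^sup>2) ^ K"
    using IH assms by (intro mult_left_mono) (auto simp: power_le_one)
  finally show ?case by simp
qed

text \<open>Each coordinate of \<open>G\<close> has a collision in a random \<open>T\<close> with
  probability at least 3/4, and the expected size of \<open>T\<close> is at most \<open>s\<close>.
  One weighted average then yields a single \<open>T\<close> satisfying both bounds.\<close>

lemma exists_small_subset_with_collisions:
  fixes v :: "'i \<Rightarrow> 'a \<Rightarrow> 'b"
  assumes "finite A" "finite G" "G \<noteq> {}" "0 \<le> p" "p \<le> 1"
    and exc: "\<And>i. i \<in> G \<Longrightarrow> card (v i ` A) + 2 * K \<le> card A + 1"
    and K: "(1 - p\<^sup>2) ^ K \<le> 1/4" and s: "p * real (card A) \<le> s" "0 < s"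
  obtains T where "T \<subseteq> A" "real (card T) \<le> 2 * s"
    "real (card G) / 2 \<le> real (card {i \<in> G. \<not> inj_on (v i) T})"
proof -
  define g where "g = real (card G)"
  define Z where "Z T = real (card {i \<in> G. \<not> inj_on (v i) T})" for T
  have g: "0 < g" using assms by (simp add: g_def card_gt_0_iff)
  have Z: "Z T = (\<Sum>i\<in>G. 1 + (-1) * of_bool (inj_on (v i) T))" for T
  proof -
    have "(\<Sum>i\<in>G. 1 + (-1) * of_bool (inj_on (v i) T)) =
        (\<Sum>i\<in>G. of_bool (\<not> inj_on (v i) T) :: real)"
      by (rule sum.cong) auto
    also have "\<dots> = Z T" using \<open>finite G\<close> by (simp add: Z_def Int_def)
    finally show ?thesis by simp
  qed
  have "g * (3/4) = (\<Sum>i\<in>G. 3/4)" by (simp add: g_def)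
  also have "\<dots> \<le> (\<Sum>i\<in>G. 1 - subset_mean p A (\<lambda>T. of_bool (inj_on (v i) T)))"
    using subset_mean_inj_on_le[OF assms(1,4,5) exc] K by (intro sum_mono) force
  also have "\<dots> = subset_mean p A Z"
    unfolding Z subset_mean_sum subset_mean_add subset_mean_cmult
    using assms(1) by (simp add: subset_mean_const)
  finally have EZ: "g * (3/4) \<le> subset_mean p A Z" .
  \<comment> \<open>Charging each element of \<open>T\<close> the price \<open>g / (4 s)\<close> controls both \<open>Z T\<close> and \<open>card T\<close>,
    because \<open>Z T\<close> never exceeds \<open>g\<close>.\<close>
  have "g / (4 * s) * (p * real (card A)) \<le> g / (4 * s) * s"
    using g s by (intro mult_left_mono) auto
  then have "g / 2 \<le> subset_mean p A Z + (- g / (4 * s)) * (p * real (card A))"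
    using EZ s by simp
  also have "\<dots> = subset_mean p A (\<lambda>T. Z T + (- g / (4 * s)) * real (card T))"
    using assms(1) by (simp only: subset_mean_add subset_mean_cmult subset_mean_card)
  finally obtain T where T: "T \<subseteq> A" "g / 2 \<le> Z T + (- g / (4 * s)) * real (card T)"
    using exists_ge_subset_mean[OF assms(1,4,5)] by (metis (no_types, lifting) order_trans)
  have "Z T \<le> g" unfolding Z_def g_def using \<open>finite G\<close> by (simp add: card_mono)
  then have "g / (4 * s) * real (card T) \<le> g / (4 * s) * (2 * s)"
    using T(2) s by simp
  then have "real (card T) \<le> 2 * s" using g s by (subst (asm) mult_le_cancel_left_pos) auto
  moreover have "0 \<le> g / (4 * s) * real (card T)" using g s by simp
  then have "g / 2 \<le> Z T" using T(2) by simp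
  ultimately show ?thesis using that T(1) by (simp add: Z_def g_def)
qed

section \<open>Uniformly random subsets of fixed size\<close>

lemma sum_power_card_Pow:
  fixes x :: real
  assumes "finite B"
  shows "(\<Sum>J\<in>Pow B. x ^ card J) = (1 + x) ^ card B"
  using assms
proof (induction B rule: finite_induct)
  case (insert b B)
  have "(\<Sum>J\<in>Pow (insert b B). x ^ card J) =
      (\<Sum>J\<in>Pow B. x ^ card J) + (\<Sum>J\<in>insert b ` Pow B. x ^ card J)"
    unfolding Pow_insert by (rule sum.union_disjoint) (use insert in auto)
  also have "(\<Sum>J\<in>insert b ` Pow B. x ^ card J) = (\<Sum>J\<in>Pow B. x ^ card (insert b J))"
    by (subst sum.reindex) (use insert in \<open>auto simp: inj_on_def\<close>)
  also have "\<dots> = (\<Sum>J\<in>Pow B. x * x ^ card J)"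
  proof (rule sum.cong[OF refl])
    fix J assume "J \<in> Pow B"
    then have "finite J" "b \<notin> J" using insert finite_subset by auto
    then show "x ^ card (insert b J) = x * x ^ card J" by simp
  qed
  finally show ?case using insert by (simp add: sum_distrib_left[symmetric] algebra_simps)
qed simp

text \<open>The quotient of the two binomials is the product of \<open>(m - i) / (n - i)\<close>
  over \<open>i < j\<close>, and each factor is at most \<open>m / n\<close>.\<close>

lemma binomial_diff_le:
  assumes "j \<le> m" "m \<le> n" "0 < n"
  shows "real ((n - j) choose (m - j)) \<le> (real m / real n) ^ j * real (n choose m)"
  using assms(1)
proof (induction j)
  case (Suc j)
  define N k where "N = n - Suc j" and "k = m - Suc j"
  have *: "n - j = Suc N" "m - j = Suc k" using Suc.prems assms by (auto simp: N_def k_def)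
  have "real (Suc k) * real (Suc N choose Suc k) = real (Suc N) * real (N choose k)"
    unfolding of_nat_mult[symmetric] by (simp only: Suc_times_binomial)
  then have "real (N choose k) = real (Suc k) / real (Suc N) * real (Suc N choose Suc k)"
    by (simp only: times_divide_eq_left) simp
  also have "real (Suc k) / real (Suc N) \<le> real m / real n"
  proof -
    have "(m - j) * n \<le> m * (n - j)"
      unfolding diff_mult_distrib diff_mult_distrib2 mult.commute[of m j]
      by (intro diff_le_mono2 mult_le_mono2 assms(2))
    then have "real (Suc k) * real n \<le> real m * real (Suc N)"
      unfolding * by (metis of_nat_mono of_nat_mult)
    then show ?thesis using assms(3) by (simp add: divide_le_eq le_divide_eq del: of_nat_Suc)
  qed
  finally have "real (N choose k) \<le> real m / real n * real (Suc N choose Suc k)"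
    by (simp add: mult_right_mono)
  also have "\<dots> \<le> real m / real n * ((real m / real n) ^ j * real (n choose m))"
    using Suc unfolding * by (intro mult_left_mono) auto
  finally show ?case by (simp add: N_def k_def)
qed simp

text \<open>Sampling without replacement contains a fixed \<open>J\<close> no more often than
  independent sampling at rate \<open>m / card V\<close> would.\<close>

lemma card_supersets_le:
  assumes "finite V" "J \<subseteq> V" "m \<le> card V" "V \<noteq> {}"
  shows "real (card {S. S \<subseteq> V \<and> card S = m \<and> J \<subseteq> S})
    \<le> (real m / real (card V)) ^ card J * real (card V choose m)"
proof (cases "card J \<le> m")
  case True
  have finJ: "finite J" using assms finite_subset by blast
  have "{S. S \<subseteq> V \<and> card S = m \<and> J \<subseteq> S} \<subseteq> (\<union>) J ` {R. R \<subseteq> V - J \<and> card R = m - card J}"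
  proof
    fix S assume S: "S \<in> {S. S \<subseteq> V \<and> card S = m \<and> J \<subseteq> S}"
    then have "S = J \<union> (S - J)" "S - J \<subseteq> V - J" "card (S - J) = m - card J"
      using finJ by (auto simp: card_Diff_subset)
    then show "S \<in> (\<union>) J ` {R. R \<subseteq> V - J \<and> card R = m - card J}" by blast
  qed
  then have "card {S. S \<subseteq> V \<and> card S = m \<and> J \<subseteq> S}
      \<le> card {R. R \<subseteq> V - J \<and> card R = m - card J}"
    using assms(1) by (intro surj_card_le) auto
  also have "\<dots> = (card V - card J) choose (m - card J)"
    using assms finJ by (simp add: n_subsets card_Diff_subset)
  finally show ?thesis
    using binomial_diff_le[OF True assms(3)] assms by (meson card_gt_0_iff of_nat_mono order_trans)
next
  case False
  have "{S. S \<subseteq> V \<and> card S = m \<and> J \<subseteq> S} = {}"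
    using False assms(1) by (auto dest: finite_subset card_mono)
  then show ?thesis unfolding \<open>_ = {}\<close> by simp
qed

lemma random_subset_intersection_tail:
  assumes "finite V" "B \<subseteq> V" "m \<le> card V" "V \<noteq> {}"
  shows "measure_pmf.prob (pmf_of_set {S. S \<subseteq> V \<and> card S = m}) {S. x \<le> real (card (S \<inter> B))}
    \<le> exp (real (card B) * real m / real (card V) - x / 2)"
proof -
  let ?O = "{S. S \<subseteq> V \<and> card S = m}"
  let ?E = "?O \<inter> {S. x \<le> real (card (S \<inter> B))}"
  let ?r = "real m / real (card V)"
  have finB: "finite B" using assms finite_subset by blast
  have finO: "finite ?O" using assms(1) by simp
  have cO: "card ?O = card V choose m" using assms(1) by (rule n_subsets)
  then have pos: "0 < card ?O" using assms(3) by simp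
  \<comment> \<open>This lets the Markov weight \<open>exp (x / 2)\<close> be compared with the base
    2 used for counting subsets.\<close>
  have e2: "exp (1/2) \<le> (2::real)"
  proof -
    have "exp (1/2) ^ 2 = exp (1::real)" by (simp add: exp_double[symmetric])
    also have "\<dots> \<le> 2\<^sup>2" using exp_le by simp
    finally show ?thesis by (rule power2_le_imp_le) simp
  qed
  \<comment> \<open>The exponential moment of \<open>card (S \<inter> B)\<close> with base 2 counts the subsets \<open>J\<close> of \<open>S \<inter> B\<close>, so
    only the probabilities of \<open>J \<subseteq> S\<close> are needed.\<close>
  have "real (card ?E) * exp (x / 2) = (\<Sum>S\<in>?E. exp (x / 2))" by simp
  also have "\<dots> \<le> (\<Sum>S\<in>?E. 2 ^ card (S \<inter> B))"
  proof (rule sum_mono)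
    fix S assume "S \<in> ?E"
    then have "exp (x / 2) \<le> exp (real (card (S \<inter> B)) * (1/2))" by simp
    also have "\<dots> = exp (1/2) ^ card (S \<inter> B)" by (rule exp_of_nat_mult)
    also have "\<dots> \<le> 2 ^ card (S \<inter> B)" using e2 by (intro power_mono) auto
    finally show "exp (x / 2) \<le> 2 ^ card (S \<inter> B)" .
  qed
  also have "\<dots> \<le> (\<Sum>S\<in>?O. 2 ^ card (S \<inter> B))"
    using finO by (intro sum_mono2) auto
  also have "\<dots> = (\<Sum>S\<in>?O. \<Sum>J\<in>Pow B. of_bool (J \<subseteq> S))"
  proof (rule sum.cong[OF refl])
    fix S assume "S \<in> ?O"
    have "(\<Sum>J\<in>Pow B. of_bool (J \<subseteq> S)) = real (card (Pow B \<inter> {J. J \<subseteq> S}))"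
      using finB by simp
    also have "Pow B \<inter> {J. J \<subseteq> S} = Pow (S \<inter> B)" by auto
    also have "real (card (Pow (S \<inter> B))) = 2 ^ card (S \<inter> B)"
      using finB by (subst card_Pow) auto
    finally show "2 ^ card (S \<inter> B) = (\<Sum>J\<in>Pow B. of_bool (J \<subseteq> S) :: real)" ..
  qed
  also have "\<dots> = (\<Sum>J\<in>Pow B. \<Sum>S\<in>?O. of_bool (J \<subseteq> S))" by (rule sum.swap)
  also have "\<dots> \<le> (\<Sum>J\<in>Pow B. ?r ^ card J * real (card ?O))"
  proof (rule sum_mono)
    fix J assume "J \<in> Pow B"
    then have "J \<subseteq> V" using assms(2) by auto
    have "(\<Sum>S\<in>?O. of_bool (J \<subseteq> S)) = real (card {S. S \<subseteq> V \<and> card S = m \<and> J \<subseteq> S})"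
      using finO by (simp add: Int_def conj_assoc)
    then show "(\<Sum>S\<in>?O. of_bool (J \<subseteq> S)) \<le> ?r ^ card J * real (card ?O)"
      using card_supersets_le[OF assms(1) \<open>J \<subseteq> V\<close> assms(3,4)] cO by simp
  qed
  also have "\<dots> = (1 + ?r) ^ card B * real (card ?O)"
    by (simp add: sum_power_card_Pow[OF finB] sum_distrib_right[symmetric])
  also have "\<dots> \<le> exp ?r ^ card B * real (card ?O)"
    by (intro mult_right_mono power_mono exp_ge_add_one_self) auto
  finally have "real (card ?E) / real (card ?O) \<le> exp ?r ^ card B / exp (x / 2)"
    using pos by (simp add: field_simps)
  also have "\<dots> = exp (real (card B) * real m / real (card V) - x / 2)"
    by (simp add: exp_diff exp_of_nat_mult[symmetric])
  finally show ?thesis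
    using finO pos card_gt_0_iff[of ?O] by (simp add: measure_pmf_of_set)
qed

section \<open>Counting small sets and their collisions\<close>

text \<open>A nonempty \<open>T\<close> is the range of a list of length exactly \<open>t\<close>:
  enumerate it and pad by repeating one of its elements.\<close>

lemma card_nonempty_subsets_le:
  assumes "finite C"
  shows "card {T. T \<subseteq> C \<and> T \<noteq> {} \<and> card T \<le> t} \<le> card C ^ t"
proof -
  have "{T. T \<subseteq> C \<and> T \<noteq> {} \<and> card T \<le> t} \<subseteq> set ` {xs. set xs \<subseteq> C \<and> length xs = t}"
  proof
    fix T assume T: "T \<in> {T. T \<subseteq> C \<and> T \<noteq> {} \<and> card T \<le> t}"
    then obtain x where x: "x \<in> T" by auto
    obtain xs where xs: "set xs = T" "distinct xs"
      using T assms finite_distinct_list finite_subset by (metis (no_types, lifting) mem_Collect_eq)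
    have "T = set (xs @ replicate (t - card T) x)" using xs x by (auto simp: set_replicate_conv_if)
    moreover have "length (xs @ replicate (t - card T) x) = t"
      using xs T by (simp add: distinct_card[symmetric])
    ultimately show "T \<in> set ` {xs. set xs \<subseteq> C \<and> length xs = t}" using T by blast
  qed
  then have "card {T. T \<subseteq> C \<and> T \<noteq> {} \<and> card T \<le> t} \<le> card {xs. set xs \<subseteq> C \<and> length xs = t}"
    using finite_lists_length_eq[OF assms] by (intro surj_card_le)
  then show ?thesis using card_lists_length_eq[OF assms] by metis
qed

text \<open>Union bound over the ordered pairs of distinct elements of \<open>T\<close>.\<close>

lemma card_collision_coordinates_le:
  assumes "finite T" "finite I"
    and agree: "\<And>c c'. c \<in> T \<Longrightarrow> c' \<in> T \<Longrightarrow> c \<noteq> c' \<Longrightarrow> card {i \<in> I. c i = c' i} \<le> D"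
  shows "card {i \<in> I. \<not> inj_on (\<lambda>c. c i) T} \<le> D * card T ^ 2"
proof -
  let ?P = "{(c, c') \<in> T \<times> T. c \<noteq> c'}"
  have finP: "finite ?P" by (rule finite_subset[of _ "T \<times> T"]) (use assms in auto)
  have "{i \<in> I. \<not> inj_on (\<lambda>c. c i) T} \<subseteq> (\<Union>x\<in>?P. {i \<in> I. fst x i = snd x i})"
    by (auto simp: inj_on_def)
  then have "card {i \<in> I. \<not> inj_on (\<lambda>c. c i) T} \<le> card (\<Union>x\<in>?P. {i \<in> I. fst x i = snd x i})"
    using finP assms by (intro card_mono) auto
  also have "\<dots> \<le> (\<Sum>x\<in>?P. card {i \<in> I. fst x i = snd x i})"
    by (rule card_UN_le[OF finP])
  also have "\<dots> \<le> (\<Sum>x\<in>?P. D)" by (rule sum_mono) (use agree in auto)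
  also have "\<dots> = D * card ?P" by simp
  also have "card ?P \<le> card (T \<times> T)" by (rule card_mono) (use assms in auto)
  finally show ?thesis using assms(1) by (simp add: power2_eq_square card_cartesian_product)
qed

section \<open>From failed list recovery to a small witness\<close>

text \<open>Lifts an oversized list of punctured words to equally many codewords of
  \<open>C\<close>, one preimage for each word.\<close>

lemma not_list_recoverable_punctureE:
  assumes "\<not> list_recoverable S q \<rho> l L (puncture C S)" "finite S" "real M \<le> L + 1"
  obtains A \<Lambda> where "\<And>i. i \<in> S \<Longrightarrow> finite (A i) \<and> card (A i) \<le> l"
    "\<Lambda> \<subseteq> C" "card \<Lambda> = M"
    "\<And>c. c \<in> \<Lambda> \<Longrightarrow> real (card {i \<in> S. c i \<notin> A i}) \<le> \<rho> * real (card S)"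
proof -
  obtain A where A: "\<And>i. i \<in> S \<Longrightarrow> A i \<subseteq> {..<q} \<and> card (A i) \<le> l"
    and L: "L < real (card {c \<in> puncture C S. dist_to_le S c (PiE S A) (\<rho> * real (card S))})"
    using assms(1) unfolding list_recoverable_def by (auto simp: not_le)
  let ?W = "{c \<in> puncture C S. dist_to_le S c (PiE S A) (\<rho> * real (card S))}"
  have finA: "finite (A i)" if "i \<in> S" for i using A[OF that] finite_subset by blast
  have "M \<le> card ?W" using L assms(3) by linarith
  then obtain W where W: "W \<subseteq> ?W" "card W = M" by (rule obtain_subset_with_card_n)
  then have "W \<subseteq> (\<lambda>c. restrict c S) ` C" by (auto simp: puncture_def)
  then obtain \<Lambda> where \<Lambda>: "\<Lambda> \<subseteq> C" "inj_on (\<lambda>c. restrict c S) \<Lambda>" "W = (\<lambda>c. restrict c S) ` \<Lambda>"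
    by (auto simp: subset_image_inj)
  have "real (card {i \<in> S. c i \<notin> A i}) \<le> \<rho> * real (card S)" if "c \<in> \<Lambda>" for c
  proof -
    have "dist_to_le S (restrict c S) (PiE S A) (\<rho> * real (card S))"
      using that W(1) \<Lambda>(3) by auto
    then have ne: "PiE S A \<noteq> {}"
      and le: "real (Min ((\<lambda>y. hamming S (restrict c S) y) ` PiE S A)) \<le> \<rho> * real (card S)"
      by (auto simp: dist_to_le_def)
    have "finite (PiE S A)" using assms(2) finA by (rule finite_PiE)
    then have "Min ((\<lambda>y. hamming S (restrict c S) y) ` PiE S A)
        \<in> (\<lambda>y. hamming S (restrict c S) y) ` PiE S A"
      using ne by (intro Min_in) auto
    then obtain y where y: "y \<in> PiE S A" "real (hamming S (restrict c S) y) \<le> \<rho> * real (card S)"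
      using le by auto
    \<comment> \<open>Where \<open>c i\<close> lies outside \<open>A i\<close> it differs from every
      word of the product, in particular from the nearest word \<open>y\<close>.\<close>
    have "card {i \<in> S. c i \<notin> A i} \<le> hamming S (restrict c S) y"
      unfolding hamming_def by (rule card_mono) (use assms(2) y(1) in \<open>auto simp: PiE_iff\<close>)
    then show ?thesis using y(2) by linarith
  qed
  moreover have "card \<Lambda> = M" using \<Lambda> W(2) by (simp add: card_image)
  ultimately show ?thesis using that A finA \<Lambda>(1) by blast
qed

text \<open>Double counting of the pairs with \<open>c i \<notin> A i\<close>. Outside the dense set
  more than a fraction \<open>1 - (1 - \<rho>)\<^sup>2 = \<rho> * (2 - \<rho>)\<close> of
  \<open>\<Lambda>\<close> misses \<open>A i\<close>, while the overall fraction of misses is at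
  most \<open>\<rho>\<close>; so at most a fraction \<open>1 / (2 - \<rho>)\<close> of
  \<open>S\<close> is not dense.\<close>

lemma card_dense_coordinates_ge:
  fixes \<rho> :: real
  assumes "finite S" "finite \<Lambda>" "\<Lambda> \<noteq> {}" "0 \<le> \<rho>" "\<rho> < 1"
    and err: "\<And>c. c \<in> \<Lambda> \<Longrightarrow> real (card {i \<in> S. c i \<notin> A i}) \<le> \<rho> * real (card S)"
  shows "(1 - \<rho>) / (2 - \<rho>) * real (card S)
    \<le> real (card {i \<in> S. (1 - \<rho>)\<^sup>2 * real (card \<Lambda>) \<le> real (card {c \<in> \<Lambda>. c i \<in> A i})})"
proof -
  let ?M = "real (card \<Lambda>)" and ?m = "real (card S)"
  let ?G = "{i \<in> S. (1 - \<rho>)\<^sup>2 * ?M \<le> real (card {c \<in> \<Lambda>. c i \<in> A i})}"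
  let ?B = "S - ?G"
  have M: "0 < ?M" using assms by (simp add: card_gt_0_iff)
  have B: "?m = real (card ?G) + real (card ?B)"
    using assms(1) by (subst card_Diff_subset) (auto simp: of_nat_diff card_mono)
  have miss: "(1 - (1 - \<rho>)\<^sup>2) * ?M < real (card {c \<in> \<Lambda>. c i \<notin> A i})" if "i \<in> ?B" for i
  proof -
    have "card \<Lambda> = card ({c \<in> \<Lambda>. c i \<in> A i} \<union> {c \<in> \<Lambda>. c i \<notin> A i})"
      by (rule arg_cong[where f = card]) auto
    also have "\<dots> = card {c \<in> \<Lambda>. c i \<in> A i} + card {c \<in> \<Lambda>. c i \<notin> A i}"
      using assms(2) by (intro card_Un_disjoint) auto
    finally have "?M = real (card {c \<in> \<Lambda>. c i \<in> A i}) + real (card {c \<in> \<Lambda>. c i \<notin> A i})" by simp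
    moreover have "\<not> (1 - \<rho>)\<^sup>2 * ?M \<le> real (card {c \<in> \<Lambda>. c i \<in> A i})" using that by auto
    ultimately show ?thesis unfolding left_diff_distrib by linarith
  qed
  have "(\<Sum>i\<in>?B. real (card {c \<in> \<Lambda>. c i \<notin> A i})) \<le> (\<Sum>i\<in>S. real (card {c \<in> \<Lambda>. c i \<notin> A i}))"
    using assms(1) by (intro sum_mono2) auto
  also have "\<dots> = (\<Sum>i\<in>S. \<Sum>c\<in>\<Lambda>. of_bool (c i \<notin> A i))"
    using assms(2) by (simp add: Int_def)
  also have "\<dots> = (\<Sum>c\<in>\<Lambda>. \<Sum>i\<in>S. of_bool (c i \<notin> A i))" by (rule sum.swap)
  also have "\<dots> = (\<Sum>c\<in>\<Lambda>. real (card {i \<in> S. c i \<notin> A i}))"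
    using assms(1) by (simp add: Int_def)
  also have "\<dots> \<le> ?M * (\<rho> * ?m)"
    using sum_bounded_above[of \<Lambda> "\<lambda>c. real (card {i \<in> S. c i \<notin> A i})"] err by simp
  finally have total: "(\<Sum>i\<in>?B. real (card {c \<in> \<Lambda>. c i \<notin> A i})) \<le> ?M * (\<rho> * ?m)" .
  have "(2 - \<rho>) * real (card ?B) \<le> ?m"
  \<comment> \<open>The general argument cancels \<open>\<rho>\<close>. For
    \<open>\<rho> = 0\<close> there are no misses at all, whereas each non-dense coordinate has at
    least one by the strict inequality in \<open>miss\<close>.\<close>
  proof (cases "\<rho> = 0")
    case True
    have "card ?B = 0"
    proof (rule ccontr)
      assume "card ?B \<noteq> 0"
      then have "(\<Sum>i\<in>?B. 0) < (\<Sum>i\<in>?B. real (card {c \<in> \<Lambda>. c i \<notin> A i}))"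
        using miss True assms(1) by (intro sum_strict_mono) (auto simp: card_eq_0_iff)
      then show False using total True by simp
    qed
    then show ?thesis by simp
  next
    case False
    have "real (card ?B) * ((1 - (1 - \<rho>)\<^sup>2) * ?M) \<le> (\<Sum>i\<in>?B. real (card {c \<in> \<Lambda>. c i \<notin> A i}))"
      using miss by (intro sum_bounded_below) (auto intro: less_imp_le)
    then have "?M * \<rho> * ((2 - \<rho>) * real (card ?B)) \<le> ?M * \<rho> * ?m"
      using total by (simp add: power2_eq_square algebra_simps)
    then show ?thesis using M False assms(4) by (subst (asm) mult_le_cancel_left_pos) auto
  qed
  then have "(1 - \<rho>) * ?m \<le> (2 - \<rho>) * real (card ?G)"
    using B by (simp add: algebra_simps)
  then show ?thesis using assms(5) by (simp add: field_simps)
qed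

lemma exists_collision_witness:
  fixes \<alpha> \<rho> :: real and l :: nat
  defines "\<gamma> \<equiv> (1 + \<alpha>) * (1 - \<rho>)\<^sup>2 - 1" and "\<sigma> \<equiv> (1 - \<rho>) / (2 - \<rho>)"
  assumes bad: "\<not> list_recoverable S q \<rho> l (real l * (1 + \<alpha>)) (puncture C S)"
    and S: "finite S" "S \<noteq> {}" and C: "finite C"
    and \<alpha>: "0 < \<alpha>" "\<alpha> < 1" and \<rho>: "0 \<le> \<rho>" "\<rho> < 1" and \<gamma>: "0 < \<gamma>" and l: "4 / \<gamma> \<le> real l"
  obtains T where "T \<subseteq> C" "T \<noteq> {}" "real (card T) \<le> 9 * sqrt (real l / \<gamma>)"
    "\<sigma> * real (card S) / 2 \<le> real (card {i \<in> S. \<not> inj_on (\<lambda>c. c i) T})"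
proof -
  \<comment> \<open>The least integer exceeding the permitted list size.\<close>
  define M where "M = nat \<lfloor>real l * (1 + \<alpha>)\<rfloor> + 1"
  have M: "real M \<le> real l * (1 + \<alpha>) + 1" "real l * (1 + \<alpha>) < real M"
    using \<alpha> by (auto simp: M_def) linarith+
  obtain A \<Lambda> where A: "\<And>i. i \<in> S \<Longrightarrow> finite (A i) \<and> card (A i) \<le> l"
    and \<Lambda>: "\<Lambda> \<subseteq> C" "card \<Lambda> = M"
    and err: "\<And>c. c \<in> \<Lambda> \<Longrightarrow> real (card {i \<in> S. c i \<notin> A i}) \<le> \<rho> * real (card S)"
    using not_list_recoverable_punctureE[OF bad S(1) M(1)] by blast
  have fin: "finite \<Lambda>" using \<Lambda>(1) C by (rule finite_subset)
  have "\<Lambda> \<noteq> {}" using \<Lambda>(2) by (auto simp: M_def)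
  define G where "G = {i \<in> S. (1 - \<rho>)\<^sup>2 * real (card \<Lambda>) \<le> real (card {c \<in> \<Lambda>. c i \<in> A i})}"
  have G: "\<sigma> * real (card S) \<le> real (card G)"
    unfolding \<sigma>_def G_def using S fin \<open>\<Lambda> \<noteq> {}\<close> \<rho> err by (intro card_dense_coordinates_ge) auto
  have "0 < \<sigma>" using \<rho> by (simp add: \<sigma>_def)
  then have "0 < \<sigma> * real (card S)" using S by (simp add: card_gt_0_iff)
  then have "card G \<noteq> 0" using G by (intro notI) simp
  then have "G \<noteq> {}" "finite G" by (auto intro: card_ge_0_finite)
  have "\<gamma> \<le> 1"
  proof -
    have "(1 - \<rho>)\<^sup>2 \<le> 1" using \<rho> by (intro power_le_one) auto
    then have "(1 + \<alpha>) * (1 - \<rho>)\<^sup>2 \<le> 1 + \<alpha>" using \<alpha> by (intro mult_left_le) auto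
    then show ?thesis using \<alpha> unfolding \<gamma>_def by linarith
  qed
  have gl: "4 \<le> \<gamma> * real l" using l \<gamma> by (simp add: field_simps)
  have l4: "4 \<le> real l" using gl mult_right_mono[OF \<open>\<gamma> \<le> 1\<close>, of "real l"] by simp
  \<comment> \<open>With these \<open>K\<close> and \<open>p\<close>,
    \<open>K * p\<^sup>2 \<ge> 2\<close>, so all \<open>K\<close> pairs are missed with probability
    at most \<open>exp (- 2) \<le> 1/4\<close>. The lower bound on \<open>l\<close> ensures
    \<open>p \<le> 1\<close>.\<close>
  define K where "K = nat \<lceil>\<gamma> * real l / 2\<rceil>"
  have K: "\<gamma> * real l / 2 \<le> real K" "real K < \<gamma> * real l / 2 + 1"
    using gl by (auto simp: K_def) linarith+
  define p where "p = 2 / sqrt (\<gamma> * real l)"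
  have root2: "2 \<le> sqrt (\<gamma> * real l)" using gl by (intro real_le_rsqrt) simp
  have p: "0 \<le> p" "p \<le> 1" using root2 gl by (auto simp: p_def divide_le_eq)
  have p2: "p\<^sup>2 = 4 / (\<gamma> * real l)" using gl by (simp add: p_def power_divide)
  have "(1 - p\<^sup>2) ^ K \<le> exp (- p\<^sup>2) ^ K"
    using p exp_ge_add_one_self[of "- p\<^sup>2"] by (intro power_mono) (auto simp: power_le_one)
  also have "\<dots> = exp (- (real K * p\<^sup>2))" by (simp add: exp_of_nat_mult[symmetric])
  also have "\<dots> \<le> exp (- 2)"
    using K(1) gl by (simp add: p2 le_divide_eq)
  also have "\<dots> \<le> 1/4"
  proof -
    have "2 \<le> exp (1::real)" using exp_ge_add_one_self[of 1] by simp
    then have "2\<^sup>2 \<le> (exp (1::real))\<^sup>2" by (intro power_mono) auto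
    also have "(exp (1::real))\<^sup>2 = exp 2" by (simp add: exp_double[symmetric])
    finally have "4 \<le> exp (2::real)" by simp
    then show ?thesis by (simp add: exp_minus field_simps)
  qed
  finally have pK: "(1 - p\<^sup>2) ^ K \<le> 1/4" .
  \<comment> \<open>The words in \<open>?N\<close> share at most \<open>l\<close> values, and there
    are at least \<open>(1 + \<gamma>) * l\<close> of them. Rounding up in \<open>K\<close> gives
    \<open>2 * K < \<gamma> * l + 2\<close>, which costs exactly the \<open>+ 1\<close>.\<close>
  have exc: "card ((\<lambda>c. c i) ` \<Lambda>) + 2 * K \<le> card \<Lambda> + 1" if i: "i \<in> G" for i
  proof -
    let ?N = "{c \<in> \<Lambda>. c i \<in> A i}"
    have "i \<in> S" using i by (simp add: G_def)
    have "(\<lambda>c. c i) ` \<Lambda> \<subseteq> A i \<union> (\<lambda>c. c i) ` (\<Lambda> - ?N)" by auto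
    then have "card ((\<lambda>c. c i) ` \<Lambda>) \<le> card (A i \<union> (\<lambda>c. c i) ` (\<Lambda> - ?N))"
      using A[OF \<open>i \<in> S\<close>] fin by (intro card_mono) auto
    also have "\<dots> \<le> card (A i) + card ((\<lambda>c. c i) ` (\<Lambda> - ?N))" by (rule card_Un_le)
    also have "\<dots> \<le> l + card (\<Lambda> - ?N)"
      using A[OF \<open>i \<in> S\<close>] fin by (intro add_mono card_image_le) auto
    finally have v: "card ((\<lambda>c. c i) ` \<Lambda>) \<le> l + card (\<Lambda> - ?N)" .
    have "card ?N \<le> card \<Lambda>" using fin by (intro card_mono) auto
    then have D: "card (\<Lambda> - ?N) + card ?N = card \<Lambda>"
      using fin by (subst card_Diff_subset) auto
    have "(1 - \<rho>)\<^sup>2 * (real l * (1 + \<alpha>)) \<le> (1 - \<rho>)\<^sup>2 * real (card \<Lambda>)"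
      using M(2) \<Lambda>(2) by (intro mult_left_mono) auto
    also have "\<dots> \<le> real (card ?N)" using i by (simp add: G_def)
    finally have "\<gamma> * real l + real l \<le> real (card ?N)" by (simp add: \<gamma>_def algebra_simps)
    then have "real (l + 2 * K) < real (card ?N + 2)" using K(2) by simp
    then have "l + 2 * K < card ?N + 2" by (subst (asm) of_nat_less_iff)
    then show ?thesis using v D by linarith
  qed
  \<comment> \<open>Since \<open>l \<ge> 4\<close>, the list has at most
    \<open>2 * l + 1 \<le> 9/4 * l\<close> words; multiplying by \<open>p\<close> gives this
    value.\<close>
  define s where "s = 9/2 * sqrt (real l / \<gamma>)"
  have "0 < s" using l4 \<gamma> by (simp add: s_def)
  have "p * real (card \<Lambda>) \<le> s"
  proof -
    have "real l * \<alpha> \<le> real l" using \<alpha> by (simp add: mult_left_le)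
    then have "real (card \<Lambda>) \<le> 9/4 * real l"
      using M(1) \<Lambda>(2) l4 unfolding distrib_left by linarith
    then have "p * real (card \<Lambda>) \<le> p * (9/4 * real l)" using p by (intro mult_left_mono)
    also have "\<dots> = 9/2 * (real l / (sqrt \<gamma> * sqrt (real l)))" by (simp add: p_def real_sqrt_mult)
    also have "\<dots> = s"
      using l4 \<gamma> by (simp add: s_def real_sqrt_divide field_simps)
    finally show ?thesis .
  qed
  obtain T where T: "T \<subseteq> \<Lambda>" "real (card T) \<le> 2 * s"
    "real (card G) / 2 \<le> real (card {i \<in> G. \<not> inj_on (\<lambda>c. c i) T})"
    using exists_small_subset_with_collisions[where v = "\<lambda>i c. c i", OF fin \<open>finite G\<close> \<open>G \<noteq> {}\<close> p exc pK
        \<open>p * real (card \<Lambda>) \<le> s\<close> \<open>0 < s\<close>] by blast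
  have "card {i \<in> G. \<not> inj_on (\<lambda>c. c i) T} \<le> card {i \<in> S. \<not> inj_on (\<lambda>c. c i) T}"
    using S by (intro card_mono) (auto simp: G_def)
  then have many: "\<sigma> * real (card S) / 2 \<le> real (card {i \<in> S. \<not> inj_on (\<lambda>c. c i) T})"
    using T(3) G by linarith
  then have "T \<noteq> {}" using \<open>0 < \<sigma> * real (card S)\<close> by auto
  with T many \<Lambda>(1) show ?thesis by (intro that[of T]) (auto simp: s_def)
qed

section \<open>Union bound over witnesses\<close>

theorem theorem2:
  fixes \<alpha> \<rho> :: real and q n d l m :: nat and C :: "(nat \<Rightarrow> nat) set"
  assumes "0 < \<alpha>" "\<alpha> < 1"
    and "0 \<le> \<rho>" "\<rho> < 1 - (1 + \<alpha>) powr (-1/2)"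
    and "0 < q" "0 < n" "0 < d" "0 < l" "0 < m"
    and "C \<subseteq> PiE {..<n} (\<lambda>_. {..<q})"
    and "min_dist_ge {..<n} C (real n - real n / real q - real d)"
    and "real d \<ge> real n / real q"
    and "4 / ((1 + \<alpha>) * (1 - \<rho>)^2 - 1) \<le> real l"
    and "real l \<le> 1/800 * ((1 - \<rho>) / (2 - \<rho>)) * ((1 + \<alpha>) * (1 - \<rho>)^2 - 1) * real n / real d"
    and "((1 - \<rho>) / (2 - \<rho>)) * real m \<ge>
           1280 * sqrt (real l / ((1 + \<alpha>) * (1 - \<rho>)^2 - 1)) * ln (real (card C))"
    and "m < n"
  shows "measure_pmf.prob (pmf_of_set {S. S \<subseteq> {..<n} \<and> card S = m})
           {S. list_recoverable S q \<rho> l (real l * (1 + \<alpha>)) (puncture C S)}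
         \<ge> 1 - exp (- ((1 - \<rho>) / (2 - \<rho>)) * real m / 64)"
proof -
  define \<gamma> where "\<gamma> = (1 + \<alpha>) * (1 - \<rho>)\<^sup>2 - 1"
  define \<sigma> where "\<sigma> = (1 - \<rho>) / (2 - \<rho>)"
  define R where "R = sqrt (real l / \<gamma>)"
  have r: "(1 + \<alpha>) powr (-1/2) = 1 / sqrt (1 + \<alpha>)"
    using powr_minus[of "1 + \<alpha>" "1/2"] powr_half_sqrt[of "1 + \<alpha>"] assms(1)
    by (simp add: inverse_eq_divide)
  have "0 < 1 / sqrt (1 + \<alpha>)" using assms(1) by simp
  then have \<rho>: "\<rho> < 1" "1 / sqrt (1 + \<alpha>) < 1 - \<rho>" using assms(4) unfolding r by linarith+
  \<comment> \<open>The upper bound on \<open>\<rho>\<close> says precisely that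
    \<open>\<gamma>\<close> is positive.\<close>
  have "(1 / sqrt (1 + \<alpha>))\<^sup>2 < (1 - \<rho>)\<^sup>2" using \<rho> assms(1) by (intro power_strict_mono) auto
  then have \<gamma>: "0 < \<gamma>" using assms(1) by (simp add: \<gamma>_def power_divide field_simps)
  have \<sigma>: "0 < \<sigma>" using \<rho> by (simp add: \<sigma>_def)
  have R: "0 \<le> R" "R\<^sup>2 = real l / \<gamma>" using \<gamma> by (auto simp: R_def)
  have finC: "finite C" using assms(10) by (rule finite_subset) (simp add: finite_PiE)
  \<comment> \<open>For an empty code this relies on the convention \<open>ln 0 = 0\<close>.\<close>
  have lnC: "0 \<le> ln (real (card C))" by (cases "card C = 0") auto
  have union: "1280 * R * ln (real (card C)) \<le> \<sigma> * real m"
    using assms(15) by (simp add: \<gamma>_def \<sigma>_def R_def)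
  have "real l \<le> 1/800 * \<sigma> * \<gamma> * real n / real d"
    using assms(14) by (simp add: \<gamma>_def \<sigma>_def)
  then have dR: "real d * R\<^sup>2 \<le> \<sigma> * real n / 800"
    using \<gamma> assms(7) by (simp add: R(2) field_simps)

  let ?O = "{S. S \<subseteq> {..<n} \<and> card S = m}"
  let ?P = "measure_pmf.prob (pmf_of_set ?O)"
  let ?good = "{S. list_recoverable S q \<rho> l (real l * (1 + \<alpha>)) (puncture C S)}"
  define t where "t = nat \<lfloor>9 * R\<rfloor>"
  have t: "real t \<le> 9 * R" using R by (simp add: t_def)
  define F where "F = {T. T \<subseteq> C \<and> T \<noteq> {} \<and> card T \<le> t}"
  define B where "B T = {i \<in> {..<n}. \<not> inj_on (\<lambda>c. c i) T}" for T :: "(nat \<Rightarrow> nat) set"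
  have finF: "finite F" using finC by (simp add: F_def)
  have O: "finite ?O" "?O \<noteq> {}"
    using obtain_subset_with_card_n[of m "{..<n}"] assms(16) by auto

  \<comment> \<open>Distinct codewords agree on at most \<open>n / q + d\<close> coordinates, and
    \<open>n / q \<le> d\<close>.\<close>
  have agree: "card {i \<in> {..<n}. c i = c' i} \<le> 2 * d" if "c \<in> C" "c' \<in> C" "c \<noteq> c'" for c c'
  proof -
    have "real n - real n / real q - real d \<le> real (hamming {..<n} c c')"
      using that assms(11) by (auto simp: min_dist_ge_def)
    moreover have "card {i \<in> {..<n}. c i = c' i} + hamming {..<n} c c'
        = card ({i \<in> {..<n}. c i = c' i} \<union> {i \<in> {..<n}. c i \<noteq> c' i})"
      unfolding hamming_def by (intro card_Un_disjoint[symmetric]) auto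
    moreover have "{i \<in> {..<n}. c i = c' i} \<union> {i \<in> {..<n}. c i \<noteq> c' i} = {..<n}" by auto
    ultimately show ?thesis using assms(12) by simp
  qed

  have bad_subset: "?O - ?good \<subseteq> (\<Union>T\<in>F. {S. \<sigma> * real m / 2 \<le> real (card (S \<inter> B T))})"
  proof
    fix S assume S: "S \<in> ?O - ?good"
    then have fS: "finite S" "S \<noteq> {}" using finite_subset assms(9) by auto
    obtain T where T: "T \<subseteq> C" "T \<noteq> {}" "real (card T) \<le> 9 * sqrt (real l / \<gamma>)"
      "\<sigma> * real (card S) / 2 \<le> real (card {i \<in> S. \<not> inj_on (\<lambda>c. c i) T})"
      using exists_collision_witness[OF _ fS finC assms(1-3) \<rho>(1), of q l] S \<gamma> assms(13)
      unfolding \<gamma>_def \<sigma>_def by blast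
    have "{i \<in> S. \<not> inj_on (\<lambda>c. c i) T} = S \<inter> B T" using S by (auto simp: B_def)
    moreover have "card T \<le> t" using T(3) by (simp add: t_def R_def le_nat_floor)
    ultimately show "S \<in> (\<Union>T\<in>F. {S. \<sigma> * real m / 2 \<le> real (card (S \<inter> B T))})"
      using T S by (auto simp: F_def)
  qed

  \<comment> \<open>The tail bound at \<open>x = \<sigma> * m / 2\<close>: the first coefficient is
    \<open>2 * 9^2 / 800\<close>, from at most \<open>2 * d * (9 * R)\<^sup>2\<close> collision
    coordinates and the bound \<open>dR\<close>.\<close>
  define b where "b = exp (162/800 * \<sigma> * real m - \<sigma> * real m / 4)"
  have tail: "?P {S. \<sigma> * real m / 2 \<le> real (card (S \<inter> B T))} \<le> b" if "T \<in> F" for T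
  proof -
    have "finite T" using that finC finite_subset by (auto simp: F_def)
    then have "card (B T) \<le> 2 * d * card T ^ 2"
      unfolding B_def using that agree by (intro card_collision_coordinates_le) (auto simp: F_def)
    then have "real (card (B T)) \<le> real (2 * d * card T ^ 2)" by (rule of_nat_mono)
    also have "\<dots> \<le> 2 * real d * (9 * R)\<^sup>2"
    proof -
      have "real (card T) \<le> 9 * R" using that t by (simp add: F_def)
      then have "(real (card T))\<^sup>2 \<le> (9 * R)\<^sup>2" by (intro power_mono) auto
      then have "2 * real d * (real (card T))\<^sup>2 \<le> 2 * real d * (9 * R)\<^sup>2"
        by (rule mult_left_mono) simp
      then show ?thesis by simp
    qed
    also have "\<dots> \<le> 162/800 * \<sigma> * real n" using dR by (simp add: power_mult_distrib)
    finally have "real (card (B T)) * real m \<le> 162/800 * \<sigma> * real n * real m"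
      by (intro mult_right_mono) auto
    then have "real (card (B T)) * real m / real n \<le> 162/800 * \<sigma> * real m"
      using assms(6) by (simp add: field_simps)
    then have "exp (real (card (B T)) * real m / real n - \<sigma> * real m / 2 / 2) \<le> b"
      unfolding b_def exp_le_cancel_iff by linarith
    moreover have "B T \<subseteq> {..<n}" "{..<n} \<noteq> {}" using assms(6) by (auto simp: B_def)
    ultimately show ?thesis
      using random_subset_intersection_tail[of "{..<n}" "B T" m "\<sigma> * real m / 2"] assms(16) by simp
  qed

  \<comment> \<open>The constant 1280 in the hypothesis on \<open>m\<close> makes the number of
    witnesses negligible against the tail bound.\<close>
  have "real (card F) \<le> real (card C) ^ t"
    unfolding F_def of_nat_power[symmetric] of_nat_le_iff by (rule card_nonempty_subsets_le[OF finC])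
  also have "\<dots> \<le> exp (real t * ln (real (card C)))"
  proof (cases "card C = 0")
    case False
    then have "exp (ln (real (card C))) = real (card C)" by (intro exp_ln) simp
    then show ?thesis unfolding exp_of_nat_mult by simp
  qed (simp add: power_0_left)
  also have "\<dots> \<le> exp (9/1280 * (\<sigma> * real m))"
  proof -
    have "real t * ln (real (card C)) \<le> 9 * R * ln (real (card C))"
      using t lnC by (intro mult_right_mono)
    then show ?thesis using union by simp
  qed
  finally have cF: "real (card F) \<le> exp (9/1280 * (\<sigma> * real m))" .

  \<comment> \<open>Only sets in the support \<open>?O\<close> carry mass, and
    \<open>bad_subset\<close> covers just those.\<close>
  have "?P (- ?good) = ?P (?O - ?good)"
    using measure_Int_set_pmf[of "pmf_of_set ?O" "- ?good"] O by (simp add: Int_commute Diff_eq)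
  also have "\<dots> \<le> ?P (\<Union>T\<in>F. {S. \<sigma> * real m / 2 \<le> real (card (S \<inter> B T))})"
    by (rule measure_pmf.finite_measure_mono[OF bad_subset]) simp
  also have "\<dots> \<le> (\<Sum>T\<in>F. ?P {S. \<sigma> * real m / 2 \<le> real (card (S \<inter> B T))})"
    using finF by (intro measure_pmf.finite_measure_subadditive_finite) auto
  also have "\<dots> \<le> (\<Sum>T\<in>F. b)" by (rule sum_mono[OF tail])
  also have "\<dots> = real (card F) * b" by simp
  also have "\<dots> \<le> exp (9/1280 * (\<sigma> * real m)) * b"
    using cF by (intro mult_right_mono) (auto simp: b_def)
  \<comment> \<open>Numerically, \<open>9/1280 + 162/800 - 1/4\<close> is about -0.0405, below
    \<open>-1/64\<close>.\<close>
  also have "\<dots> \<le> exp (- \<sigma> * real m / 64)"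
  proof -
    have "0 \<le> \<sigma> * real m" using \<sigma> by simp
    then show ?thesis unfolding b_def exp_add[symmetric] exp_le_cancel_iff by linarith
  qed
  finally have "?P (- ?good) \<le> exp (- \<sigma> * real m / 64)" .
  moreover have "?P (- ?good) = 1 - ?P ?good"
    using measure_pmf.prob_compl[of ?good "pmf_of_set ?O"] by (simp add: Compl_eq_Diff_UNIV)
  ultimately show ?thesis by (simp add: \<sigma>_def)
qed

end
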